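(* For all integers $k\ge 1$ and $\ell,m\ge 0$, there are only finitely many (up to isomorphism) $k$-vertex-critical graphs that are simultaneously $(P_4+\ell P_1)$-free, $B_{4,m}$-free and $B_{3,m}^{+}$-free.
   Context: All graphs are finite and simple. A graph $G$ is $k$-vertex-critical if $\chi(G)=k$ but $\chi(G-v)<k$ for every $v\in V(G)$. A graph is $H$-free if it has no induced subgraph isomorphic to $H$. $P_n$ is the path on $n$ vertices, $P_1$ a single vertex, and $G_1+G_2$ denotes the disjoint union; $P_4+\ell P_1$ is the disjoint union of $P_4$ and $\ell$ isolated vertices. $B_{4,m}$ is the graph obtained from the path $u_1u_2u_3u_4$ by adding $m$ new vertices $w_1,\dots,w_m$ each adjacent only to $u_4$ (i.e. identifying a leaf of $P_4$ with the centre of $K_{1,m}$). $B_{3,m}^{+}$ is the graph with vertices $u_1,u_2,u_3,x,w_1,\dots,w_m$ and edges $u_1u_2$, $u_2u_3$, $u_2x$, $u_3x$ and $u_3w_i$ for $1\le i\le m$ (i.e. the path $u_1u_2u_3$ with $u_3$ identified with the centre of $K_{1,m}$, and a triangle $u_2u_3x$ added on the edge $u_2u_3$). *)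

theory Defs
  imports "Graph_Theory.Graph_Theory"
begin

text \<open>
  Finite simple graphs are the symmetric loop-free finite digraphs of the locale \<^locale>\<open>graph\<close>
  and, with arcs given as pairs of vertices, of \<^locale>\<open>pair_graph\<close>: each undirected
  edge is represented by its two opposite arcs.
\<close>

subsection \<open>Colourings and vertex-critical graphs\<close>

definition colourable :: "('a, 'b) pre_digraph \<Rightarrow> nat \<Rightarrow> bool" where
  "colourable G n \<longleftrightarrow>
     (\<exists>c :: 'a \<Rightarrow> nat. (\<forall>v \<in> verts G. c v < n) \<and> (\<forall>u v. u \<rightarrow>\<^bsub>G\<^esub> v \<longrightarrow> c u \<noteq> c v))"

definition chromatic_number :: "('a, 'b) pre_digraph \<Rightarrow> nat" where
  "chromatic_number G = (LEAST n. colourable G n)"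

definition vertex_critical :: "nat \<Rightarrow> ('a, 'b) pre_digraph \<Rightarrow> bool" where
  "vertex_critical k G \<longleftrightarrow> graph G \<and> chromatic_number G = k \<and>
     (\<forall>v \<in> verts G. chromatic_number (pre_digraph.del_vert G v) < k)"

text \<open>The least element in \<^const>\<open>chromatic_number\<close> is over a nonempty set.\<close>

lemma (in graph) colourable_order: "colourable G (card (verts G))"
proof -
  obtain c where c: "bij_betw c (verts G) {0..<card (verts G)}"
    using finite_verts by (meson ex_bij_betw_finite_nat)
  have "c u \<noteq> c v" if "u \<rightarrow>\<^bsub>G\<^esub> v" for u v
    using that c adj_not_same[of u] adj_in_verts[of u v]
    by (metis bij_betw_imp_inj_on inj_on_eq_iff)
  then show ?thesis
    using bij_betwE[OF c] unfolding colourable_def by auto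
qed

subsection \<open>Induced subgraphs and forbidden graphs\<close>

definition induced_free :: "('c, 'd) pre_digraph \<Rightarrow> ('a, 'b) pre_digraph \<Rightarrow> bool" where
  "induced_free H G \<longleftrightarrow> \<not> (\<exists>F. induced_subgraph F G \<and> digraph_iso F H)"

text \<open>
  The graphs below live on the vertices \<open>{..<4 + n}\<close>; \<open>(R)\<^sup>s\<close> is the symmetric closure of \<open>R\<close>.
\<close>

text \<open>\<open>P\<^sub>4 + l P\<^sub>1\<close>: the path is \<open>0, 1, 2, 3\<close>.\<close>

definition P4_plus_P1s :: "nat \<Rightarrow> nat pair_pre_digraph" where
  "P4_plus_P1s l = \<lparr> pverts = {..<4 + l}, parcs = ({(0, 1), (1, 2), (2, 3)})\<^sup>s \<rparr>"

text \<open>\<open>B\<^sub>4\<^sub>,\<^sub>m\<close>: \<open>u\<^sub>1, u\<^sub>2, u\<^sub>3, u\<^sub>4\<close> are \<open>0, 1, 2, 3\<close>, and the \<open>w\<^sub>i\<close> are \<open>4, \<dots>, m + 3\<close>.\<close>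

definition B4 :: "nat \<Rightarrow> nat pair_pre_digraph" where
  "B4 m = \<lparr> pverts = {..<4 + m},
            parcs = ({(0, 1), (1, 2), (2, 3)} \<union> {3} \<times> {4..<4 + m})\<^sup>s \<rparr>"

text \<open>\<open>B\<^sub>3\<^sub>,\<^sub>m\<^sup>+\<close>: \<open>u\<^sub>1, u\<^sub>2, u\<^sub>3, x\<close> are \<open>0, 1, 2, 3\<close>, and the \<open>w\<^sub>i\<close> are \<open>4, \<dots>, m + 3\<close>.\<close>

definition B3_plus :: "nat \<Rightarrow> nat pair_pre_digraph" where
  "B3_plus m = \<lparr> pverts = {..<4 + m},
                 parcs = ({(0, 1), (1, 2), (1, 3), (2, 3)} \<union> {2} \<times> {4..<4 + m})\<^sup>s \<rparr>"

lemma pair_graph_symcl: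
  assumes "finite V" "R \<subseteq> V \<times> V" "irrefl R"
  shows "pair_graph \<lparr> pverts = V, parcs = R\<^sup>s \<rparr>"
proof -
  have "finite R" using assms finite_subset by blast
  then show ?thesis using assms
    by unfold_locales (auto simp: symcl_def symmetric_def irrefl_def intro: symI)
qed

lemma pair_graph_forbidden:
  "pair_graph (P4_plus_P1s l)" "pair_graph (B4 m)" "pair_graph (B3_plus m)"
  unfolding P4_plus_P1s_def B4_def B3_plus_def
  by (rule pair_graph_symcl; auto simp: irrefl_def)+

subsection \<open>Isomorphism classes\<close>

definition graph_iso_rel :: "'a pair_pre_digraph rel" where
  "graph_iso_rel = {(G, H). pair_graph G \<and> pair_graph H \<and> digraph_iso (with_proj G) (with_proj H)}"

definition finite_up_to_iso :: "'a pair_pre_digraph set \<Rightarrow> bool" where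
  "finite_up_to_iso \<G> \<longleftrightarrow> finite (\<G> // graph_iso_rel)"

lemma digraph_iso_pair_iff:
  assumes "pair_wf_digraph G"
  shows "digraph_iso (with_proj G) (with_proj H) \<longleftrightarrow>
    (\<exists>f. inj_on f (pverts G) \<and> pverts H = f ` pverts G \<and> parcs H = map_prod f f ` parcs G)"
    (is "?L \<longleftrightarrow> ?R")
proof
  interpret pair_wf_digraph G by fact
  assume ?L
  then obtain h where h: "digraph_isomorphism h" "with_proj H = app_iso h (with_proj G)"
    by (auto simp: digraph_iso_def)
  have "arcs_ends (with_proj H) = (\<lambda>(u, v). (iso_verts h u, iso_verts h v)) ` parcs G"
    unfolding h(2) using arcs_ends_app_iso_eq[OF h(1)] by simp
  moreover have "pverts H = iso_verts h ` pverts G"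
    using arg_cong[OF h(2), of verts] by simp
  ultimately show ?R
    using digraph_isomorphism_inj_on_verts[OF h(1)]
    by (intro exI[of _ "iso_verts h"]) (auto simp: map_prod_def)
next
  interpret pair_wf_digraph G by fact
  assume ?R
  then obtain f where f: "inj_on f (pverts G)" "pverts H = f ` pverts G"
    "parcs H = map_prod f f ` parcs G" by blast
  have "parcs G \<subseteq> pverts G \<times> pverts G"
    using in_arcsD1 in_arcsD2 by auto
  then have "inj_on (map_prod f f) (parcs G)"
    using map_prod_inj_on[OF f(1) f(1)] inj_on_subset by blast
  then show ?L
    using f wf_digraph unfolding digraph_iso_def digraph_isomorphism_def
    by (intro exI[of _ "\<lparr>iso_verts = f, iso_arcs = map_prod f f, iso_head = snd, iso_tail = fst\<rparr>"])
       (auto simp: app_iso_def with_proj_def)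
qed

lemma equiv_graph_iso_rel: "equiv {G :: 'a pair_pre_digraph. pair_graph G} graph_iso_rel"
proof (rule equivI)
  have wf: "pair_wf_digraph G" if "pair_graph G" for G :: "'a pair_pre_digraph"
    using that by (rule pair_digraph.pair_wf_digraph[OF pair_graph.axioms(1)])
  show "graph_iso_rel \<subseteq> {G :: 'a pair_pre_digraph. pair_graph G} \<times> {G. pair_graph G}"
    by (auto simp: graph_iso_rel_def)
  show "refl_on {G :: 'a pair_pre_digraph. pair_graph G} graph_iso_rel"
    by (rule refl_onI)
       (auto simp: graph_iso_rel_def digraph_iso_pair_iff wf map_prod.id intro!: exI[of _ id])
  show "sym (graph_iso_rel :: 'a pair_pre_digraph rel)"
  proof (rule symI)
    fix G H :: "'a pair_pre_digraph"
    assume GH: "(G, H) \<in> graph_iso_rel"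
    then obtain f where g: "pair_graph G" "pair_graph H"
      and f: "inj_on f (pverts G)" "pverts H = f ` pverts G" "parcs H = map_prod f f ` parcs G"
      by (auto simp: graph_iso_rel_def digraph_iso_pair_iff wf)
    interpret pair_wf_digraph G using g wf by blast
    let ?g = "the_inv_into (pverts G) f"
    have "map_prod ?g ?g (map_prod f f e) = e" if "e \<in> parcs G" for e
      using that f(1) in_arcsD1 in_arcsD2 by (cases e) (auto simp: the_inv_into_f_f)
    then have "parcs G = map_prod ?g ?g ` parcs H"
      unfolding f(3) by (auto simp: image_image)
    moreover have "inj_on ?g (pverts H)" "pverts G = ?g ` pverts H"
      using f by (auto simp: inj_on_the_inv_into the_inv_into_onto)
    ultimately show "(H, G) \<in> graph_iso_rel"
      using g by (auto simp: graph_iso_rel_def digraph_iso_pair_iff wf)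
  qed
  show "trans (graph_iso_rel :: 'a pair_pre_digraph rel)"
  proof (rule transI)
    fix G H K :: "'a pair_pre_digraph"
    assume "(G, H) \<in> graph_iso_rel" "(H, K) \<in> graph_iso_rel"
    then obtain f f' where g: "pair_graph G" "pair_graph H" "pair_graph K"
      and f: "inj_on f (pverts G)" "pverts H = f ` pverts G" "parcs H = map_prod f f ` parcs G"
      and f': "inj_on f' (pverts H)" "pverts K = f' ` pverts H" "parcs K = map_prod f' f' ` parcs H"
      by (auto simp: graph_iso_rel_def digraph_iso_pair_iff wf)
    have "inj_on (f' \<circ> f) (pverts G)" "pverts K = (f' \<circ> f) ` pverts G"
      "parcs K = map_prod (f' \<circ> f) (f' \<circ> f) ` parcs G"
      using f f' by (auto simp: comp_inj_on image_comp map_prod_compose)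
    then show "(G, K) \<in> graph_iso_rel"
      using g unfolding graph_iso_rel_def by (auto simp only: digraph_iso_pair_iff[OF wf] mem_Collect_eq case_prod_conv)
  qed
qed

end

theory Submission
  imports Defs
begin

text \<open>
  It suffices to bound the size of a maximal independent set \<open>S\<close>, as the graph is covered by \<open>k\<close>
  independent sets. Let \<open>M v\<close> be the closed neighbourhood of \<open>v\<close> within \<open>S\<close>. If \<open>S\<close> is large, then
  vertices with small \<open>M v\<close> induce no \<open>P\<^sub>4\<close>, which makes their sets \<open>M v\<close> laminar; together with the
  two brooms and criticality this leaves only vertices with \<open>M v\<close> a singleton \<open>{i}\<close>, forming pairwise
  anticomplete parts \<open>K i\<close>, and vertices with \<open>M v\<close> large. Of the latter, those mixed on some part
  are complete to all but boundedly many parts by \<open>P\<^sub>4 + l P\<^sub>1\<close>-freeness, and the sets \<open>M v\<close> of the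
  others are laminar up to \<open>m\<close> elements by freeness of the brooms. A least such set indexes a large
  family of parts to each of which the outside attaches almost completely or not at all, and a
  recolouring argument excludes such families in critical graphs.
\<close>

section \<open>Colourings of vertex subsets, relative to an adjacency relation\<close>

definition proper_colouring :: "('a \<Rightarrow> 'a \<Rightarrow> bool) \<Rightarrow> 'a set \<Rightarrow> ('a \<Rightarrow> nat) \<Rightarrow> bool" where
  "proper_colouring adj X c \<longleftrightarrow> (\<forall>u\<in>X. \<forall>v\<in>X. adj u v \<longrightarrow> c u \<noteq> c v)"

definition independent :: "('a \<Rightarrow> 'a \<Rightarrow> bool) \<Rightarrow> 'a set \<Rightarrow> bool" where
  "independent adj W \<longleftrightarrow> (\<forall>u\<in>W. \<forall>v\<in>W. \<not> adj u v)"

definition chi :: "('a \<Rightarrow> 'a \<Rightarrow> bool) \<Rightarrow> 'a set \<Rightarrow> nat" where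
  "chi adj X = (LEAST q. \<exists>c. proper_colouring adj X c \<and> c ` X \<subseteq> {..<q})"

lemma independentD: "independent adj W \<Longrightarrow> u \<in> W \<Longrightarrow> v \<in> W \<Longrightarrow> \<not> adj u v"
  by (auto simp: independent_def)

lemma proper_colouringD:
  "proper_colouring adj X c \<Longrightarrow> adj u v \<Longrightarrow> u \<in> X \<Longrightarrow> v \<in> X \<Longrightarrow> c u \<noteq> c v"
  by (auto simp: proper_colouring_def)

lemma proper_colouring_subset:
  "proper_colouring adj X c \<Longrightarrow> Y \<subseteq> X \<Longrightarrow> proper_colouring adj Y c"
  by (auto simp: proper_colouring_def)

lemma proper_colouring_comp:
  "proper_colouring adj X c \<Longrightarrow> inj_on f (c ` X) \<Longrightarrow> proper_colouring adj X (f \<circ> c)"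
  by (auto simp: proper_colouring_def inj_on_def)

text \<open>Every colouring of \<open>Y\<close> shows at least \<open>chi adj Y\<close> colours,
  hence at least \<open>chi adj X\<close>. An optimal colouring of \<open>X\<close> can therefore be
  renamed injectively into the colours that occur on \<open>Y\<close>: one vertex set borrows the
  palette of another.\<close>

lemma colouring_from_chi_le:
  assumes "finite X" "finite Y" and irrefl: "\<And>u. \<not> adj u u"
    and le: "chi adj X \<le> chi adj Y" and c: "proper_colouring adj Y c"
  obtains c' where "proper_colouring adj X c'" "c' ` X \<subseteq> c ` Y"
proof -
  have fin: "finite (c ` Y)" using assms by simp
  then obtain f where f: "bij_betw f (c ` Y) {0..<card (c ` Y)}"
    using ex_bij_betw_finite_nat by blast
  have "proper_colouring adj Y (f \<circ> c)"
    using c f by (auto intro: proper_colouring_comp bij_betw_imp_inj_on)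
  moreover have "(f \<circ> c) ` Y \<subseteq> {..<card (c ` Y)}"
    using bij_betwE[OF f] by auto
  ultimately have "chi adj Y \<le> card (c ` Y)"
    unfolding chi_def by (intro Least_le) blast
  obtain h where h: "bij_betw h X {0..<card X}"
    using assms(1) ex_bij_betw_finite_nat by blast
  have "proper_colouring adj X h"
    using bij_betw_imp_inj_on[OF h] irrefl unfolding proper_colouring_def
    by (metis inj_on_eq_iff)
  moreover have "h ` X \<subseteq> {..<card X}"
    using bij_betwE[OF h] by auto
  ultimately have "\<exists>q c. proper_colouring adj X c \<and> c ` X \<subseteq> {..<q}" by blast
  from LeastI_ex[OF this] obtain c0
    where c0: "proper_colouring adj X c0" "c0 ` X \<subseteq> {..<chi adj X}"
    unfolding chi_def by blast
  then have sub: "c0 ` X \<subseteq> {0..<card (c ` Y)}"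
    using le \<open>chi adj Y \<le> card (c ` Y)\<close> by fastforce
  let ?g = "the_inv_into (c ` Y) f"
  have g: "bij_betw ?g {0..<card (c ` Y)} (c ` Y)"
    by (rule bij_betw_the_inv_into[OF f])
  have "proper_colouring adj X (?g \<circ> c0)"
    using proper_colouring_comp[OF c0(1)] inj_on_subset[OF bij_betw_imp_inj_on[OF g] sub] by blast
  moreover have "(?g \<circ> c0) ` X \<subseteq> c ` Y"
    using sub bij_betwE[OF g] by auto
  ultimately show thesis by (rule that)
qed

subsection \<open>Recolouring in critical graphs\<close>

text \<open>Here \<open>n\<close> stands for \<open>k - 1\<close>: the number of colours that fails
  on \<open>V\<close> but suffices once any vertex is deleted.\<close>

locale critical_graph =
  fixes V :: "'a set" and adj :: "'a \<Rightarrow> 'a \<Rightarrow> bool" and n :: nat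
  assumes finite_V: "finite V"
    and adj_in_V: "adj u v \<Longrightarrow> u \<in> V"
    and adj_sym: "adj u v \<Longrightarrow> adj v u"
    and adj_irrefl: "\<not> adj u u"
    and not_colourable: "\<not> (\<exists>c. proper_colouring adj V c \<and> c ` V \<subseteq> {..<n})"
    and del_colourable:
      "v \<in> V \<Longrightarrow> \<exists>c. proper_colouring adj (V - {v}) c \<and> c ` (V - {v}) \<subseteq> {..<n}"
begin

text \<open>After deleting one vertex of the clique, the others receive distinct colours among
  \<open>n\<close>.\<close>

lemma clique_card_le:
  assumes W: "W \<subseteq> V" and clique: "\<And>u v. u \<in> W \<Longrightarrow> v \<in> W \<Longrightarrow> u \<noteq> v \<Longrightarrow> adj u v"
  shows "card W \<le> n + 1"
proof (cases "W = {}")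
  case False
  then obtain v where v: "v \<in> W" by blast
  with W obtain c where c: "proper_colouring adj (V - {v}) c" "c ` (V - {v}) \<subseteq> {..<n}"
    using del_colourable by blast
  have "inj_on c (W - {v})"
  proof (intro inj_onI, rule ccontr)
    fix x y assume xy: "x \<in> W - {v}" "y \<in> W - {v}" "c x = c y" "x \<noteq> y"
    then have "adj x y" "x \<in> V - {v}" "y \<in> V - {v}" using clique W by auto
    then show False using proper_colouringD[OF c(1)] xy(3) by blast
  qed
  moreover have "c ` (W - {v}) \<subseteq> {..<n}" using c W by blast
  ultimately have "card (W - {v}) \<le> n"
    using card_inj_on_le[of c "W - {v}" "{..<n}"] by simp
  then show ?thesis using v finite_subset[OF W finite_V] by simp
qed simp

text \<open>Deleting one vertex leaves \<open>n\<close> colour classes, each of them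
  independent.\<close>

lemma card_le_of_independent_bound:
  assumes bound: "\<And>W. W \<subseteq> V \<Longrightarrow> independent adj W \<Longrightarrow> card W \<le> N"
  shows "card V \<le> n * N + 1"
proof (cases "V = {}")
  case False
  then obtain v where v: "v \<in> V" by blast
  then obtain c where c: "proper_colouring adj (V - {v}) c" "c ` (V - {v}) \<subseteq> {..<n}"
    using del_colourable by blast
  have "V - {v} = (\<Union>t<n. {u \<in> V - {v}. c u = t})" using c(2) by auto
  then have "card (V - {v}) \<le> (\<Sum>t<n. card {u \<in> V - {v}. c u = t})"
    by (metis card_UN_le finite_lessThan)
  also have "\<dots> \<le> (\<Sum>t<n. N)"
  proof (intro sum_mono bound)
    fix t
    show "independent adj {u \<in> V - {v}. c u = t}"
      using proper_colouringD[OF c(1)] by (fastforce simp: independent_def)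
  qed auto
  finally show ?thesis using v finite_V by simp
qed simp

text \<open>
  Remove the member with least chromatic number. In a colouring of the rest, call a colour popular
  if it occurs on at least \<open>e\<close> members; no neighbour of the removed member has a popular colour.
  Some member has popular colours only, and these suffice to colour the removed one.
\<close>

lemma no_near_homogeneous_family:
  fixes K :: "'i \<Rightarrow> 'a set"
  assumes fin: "finite A"
    and K: "\<And>i. i \<in> A \<Longrightarrow> K i \<noteq> {}" "\<And>i. i \<in> A \<Longrightarrow> K i \<subseteq> V"
    and disj: "\<And>i j. i \<in> A \<Longrightarrow> j \<in> A \<Longrightarrow> i \<noteq> j \<Longrightarrow> K i \<inter> K j = {}"
    and attach: "\<And>i z a. i \<in> A \<Longrightarrow> z \<in> V \<Longrightarrow> z \<notin> K i \<Longrightarrow> a \<in> K i \<Longrightarrow> adj z a \<Longrightarrow>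
        card {j \<in> A - {i}. \<exists>a\<in>K j. \<not> adj z a} < e"
    and large: "n * (e - 1) + 1 < card A"
  shows False
proof -
  have "A \<noteq> {}" using large by auto
  then obtain i where i: "i \<in> A" and min: "\<And>j. j \<in> A \<Longrightarrow> chi adj (K i) \<le> chi adj (K j)"
    by (meson arg_min_if_finite(1) arg_min_least fin)
  obtain v where v: "v \<in> K i" using K i by blast
  then obtain c where c: "proper_colouring adj (V - {v}) c" "c ` (V - {v}) \<subseteq> {..<n}"
    using del_colourable K i by blast
  \<comment> \<open>\<open>J t\<close> collects the members other than \<open>i\<close> on which
    colour \<open>t\<close> occurs; \<open>t\<close> is popular if there are at least
    \<open>e\<close> of them.\<close>
  define J where "J t = {j \<in> A - {i}. t \<in> c ` K j}" for t
  have finJ: "finite (J t)" for t unfolding J_def using fin by simp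
  \<comment> \<open>Unpopular colours occur on at most \<open>n * (e - 1)\<close> members in total,
    so some \<open>j\<close> other than \<open>i\<close> avoids them all.\<close>
  let ?U = "\<Union>t\<in>{t. t < n \<and> card (J t) < e}. J t"
  have "card ?U \<le> (\<Sum>t\<in>{t. t < n \<and> card (J t) < e}. card (J t))"
    by (intro card_UN_le) simp
  also have "\<dots> \<le> (\<Sum>t\<in>{t. t < n \<and> card (J t) < e}. e - 1)"
    by (intro sum_mono) auto
  also have "\<dots> \<le> n * (e - 1)"
    using card_mono[of "{..<n}" "{t. t < n \<and> card (J t) < e}"] by (auto intro!: mult_le_mono1)
  also have "\<dots> < card (A - {i})" using large i fin by simp
  finally have "\<not> A - {i} \<subseteq> ?U"
    using card_mono[of ?U "A - {i}"] finJ by auto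
  then obtain j where j: "j \<in> A - {i}" "\<And>t. t < n \<Longrightarrow> card (J t) < e \<Longrightarrow> j \<notin> J t" by blast
  have sub: "K h \<subseteq> V - {v}" if "h \<in> A - {i}" for h
    using that K disj i v by blast
  have popular: "e \<le> card (J t)" if "t \<in> c ` K j" for t
  proof (rule ccontr)
    assume "\<not> e \<le> card (J t)"
    moreover have "t < n" using that c(2) sub[OF j(1)] by auto
    ultimately show False using j that by (auto simp: J_def)
  qed
  have finK: "finite (K h)" if "h \<in> A" for h using K that finite_V finite_subset by blast
  obtain c' where c': "proper_colouring adj (K i) c'" "c' ` K i \<subseteq> c ` K j"
  proof (rule colouring_from_chi_le[of "K i" "K j"])
    show "proper_colouring adj (K j) c"
      using c(1) sub[OF j(1)] proper_colouring_subset by blast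
  qed (use min j i finK adj_irrefl in auto)
  let ?d = "\<lambda>u. if u \<in> K i then c' u else c u"
  \<comment> \<open>Each member in \<open>J (c z)\<close> contains a vertex coloured like
    \<open>z\<close>, hence not adjacent to \<open>z\<close>. If \<open>c z\<close> were popular,
    there would be at least \<open>e\<close> such members, against \<open>attach\<close>.\<close>
  have cross: "c' a \<noteq> c z" if a: "a \<in> K i" and z: "z \<in> V" "z \<notin> K i" and adj: "adj z a" for a z
  proof
    assume eq: "c' a = c z"
    then have "e \<le> card (J (c z))" using popular c'(2) a by (metis image_subset_iff)
    moreover have "J (c z) \<subseteq> {j \<in> A - {i}. \<exists>a\<in>K j. \<not> adj z a}"
    proof
      fix h assume "h \<in> J (c z)"
      then obtain b where h: "h \<in> A - {i}" "b \<in> K h" "c z = c b" by (auto simp: J_def)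
      then have "\<not> adj z b"
        using proper_colouringD[OF c(1), of z b] sub z v by auto
      with h show "h \<in> {j \<in> A - {i}. \<exists>a\<in>K j. \<not> adj z a}" by auto
    qed
    then have "card (J (c z)) \<le> card {j \<in> A - {i}. \<exists>a\<in>K j. \<not> adj z a}"
      using fin by (intro card_mono) auto
    ultimately show False using attach[OF i z a adj] by simp
  qed
  have "proper_colouring adj V ?d"
    unfolding proper_colouring_def
  proof (intro ballI impI)
    fix u w assume uw: "u \<in> V" "w \<in> V" "adj u w"
    then show "?d u \<noteq> ?d w"
      using cross[of u w] cross[of w u] adj_sym[of u w] v
        proper_colouringD[OF c'(1), of u w] proper_colouringD[OF c(1), of u w]
      by (cases "u \<in> K i"; cases "w \<in> K i") force+
  qed
  moreover have "?d ` V \<subseteq> {..<n}"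
  proof -
    have "c ` K j \<subseteq> {..<n}" using c(2) sub[OF j(1)] by blast
    moreover have "c ` (V - K i) \<subseteq> {..<n}" using c(2) v by blast
    ultimately show ?thesis using c'(2) by (auto simp: image_subset_iff)
  qed
  ultimately show False using not_colourable by blast
qed

end

subsection \<open>Vertices with few neighbours in a large independent set\<close>

text \<open>Each forbidden graph is a core of four vertices with an independent set attached
  uniformly, so freeness becomes a bound on \<open>W\<close>. The adjacency pattern already forces
  the core vertices to be distinct and outside \<open>W\<close>.\<close>

locale free_critical_graph = critical_graph V adj n
  for V :: "'a set" and adj n +
  fixes l m :: nat
  assumes P4_free: "\<lbrakk>adj a b; adj b c; adj c d; \<not> adj a c; \<not> adj a d; \<not> adj b d;
      W \<subseteq> V; independent adj W;
      \<And>w. w \<in> W \<Longrightarrow> \<not> adj w a \<and> \<not> adj w b \<and> \<not> adj w c \<and> \<not> adj w d\<rbrakk> \<Longrightarrow> card W < l"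
    and B4_free: "\<lbrakk>adj a b; adj b c; adj c d; \<not> adj a c; \<not> adj a d; \<not> adj b d;
      W \<subseteq> V; independent adj W;
      \<And>w. w \<in> W \<Longrightarrow> \<not> adj w a \<and> \<not> adj w b \<and> \<not> adj w c \<and> adj w d\<rbrakk> \<Longrightarrow> card W < m"
    and B3_plus_free: "\<lbrakk>adj a b; adj b c; adj b x; adj c x; \<not> adj a c; \<not> adj a x;
      W \<subseteq> V; independent adj W;
      \<And>w. w \<in> W \<Longrightarrow> \<not> adj w a \<and> \<not> adj w b \<and> adj w c \<and> \<not> adj w x\<rbrakk> \<Longrightarrow> card W < m"
begin

text \<open>The two brooms cover both states of the pair \<open>b\<close>, \<open>d\<close>: if
  adjacent, then \<open>b\<close>, \<open>d\<close>, \<open>c\<close> is the triangle of a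
  \<open>B3_plus\<close> with centre \<open>d\<close>; otherwise \<open>a\<close>, \<open>b\<close>,
  \<open>c\<close>, \<open>d\<close> is the path of a \<open>B4\<close>. Later arguments need not
  decide this edge.\<close>

lemma broom_free:
  assumes "adj a b" "adj b c" "\<not> adj a c" "adj c d" "\<not> adj a d" "a \<noteq> d"
    and W: "W \<subseteq> V" "independent adj W"
    and "\<And>w. w \<in> W \<Longrightarrow> \<not> adj w a \<and> \<not> adj w b \<and> \<not> adj w c \<and> adj w d"
  shows "card W < m"
proof (cases "adj b d")
  case True
  then show ?thesis
    using assms adj_sym by (intro B3_plus_free[of a b d c W]) blast+
next
  case False
  then show ?thesis using assms by (intro B4_free[of a b c d W]) blast+
qed

text \<open>One bound for two defects: a mixed vertex fails to be complete to fewer than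
  \<open>l + 2\<close> parts, and almost laminar sets lose fewer than \<open>m\<close>
  elements.\<close>

definition gap :: nat where "gap = l + m + 2"

text \<open>\<open>(n + 1) * gap\<close> is the size that every \<open>M v\<close> with at least two
  elements will turn out to exceed; \<open>(n + 2) * m\<close> leaves room for a chain of
  \<open>n + 2\<close> steps, each adding fewer than \<open>m\<close> elements.\<close>

definition low_bound :: nat where "low_bound = (n + 1) * gap + (n + 2) * m"

end

locale large_independent_set = free_critical_graph V adj n l m
  for V :: "'a set" and adj n l m +
  fixes S :: "'a set"
  assumes S_subset: "S \<subseteq> V"
    and S_indep: "independent adj S"
    and S_maximal: "v \<in> V \<Longrightarrow> v \<notin> S \<Longrightarrow> \<exists>s\<in>S. adj v s"
    and S_large: "4 * low_bound + l \<le> card S"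
begin

text \<open>Admitting \<open>s = v\<close> gives \<open>M s = {s}\<close> for \<open>s\<close> in
  \<open>S\<close>, so elements of \<open>S\<close> are treated like all other vertices.\<close>

definition M :: "'a \<Rightarrow> 'a set" where "M v = {s \<in> S. s = v \<or> adj v s}"

definition low :: "'a \<Rightarrow> bool" where "low v \<longleftrightarrow> v \<in> V \<and> card (M v) \<le> low_bound"

definition K :: "'a \<Rightarrow> 'a set" where "K i = {v \<in> V. M v = {i}}"

section \<open>Elementary facts about closed neighbourhoods in \<open>S\<close>\<close>

lemma finite_S: "finite S" using S_subset finite_V finite_subset by blast

lemma M_subset: "M v \<subseteq> S" by (auto simp: M_def)

lemma finite_M: "finite (M v)" using M_subset finite_S finite_subset by blast

lemma M_nonempty: "v \<in> V \<Longrightarrow> M v \<noteq> {}"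
  using S_maximal by (auto simp: M_def)

lemma M_in_S: "s \<in> S \<Longrightarrow> M s = {s}"
  using S_indep by (auto simp: M_def independent_def)

lemma M_adj: "s \<in> M v \<Longrightarrow> v \<notin> S \<Longrightarrow> adj v s"
  by (auto simp: M_def)

lemma in_M_if_adj: "adj v s \<Longrightarrow> s \<in> S \<Longrightarrow> s \<in> M v"
  by (auto simp: M_def)

lemma low_bound_pos: "2 \<le> low_bound"
  by (simp add: low_bound_def gap_def)

lemma low_S: "s \<in> S \<Longrightarrow> low s"
  using M_in_S S_subset low_bound_pos by (auto simp: low_def)

lemma not_in_S: "2 \<le> card (M v) \<Longrightarrow> v \<notin> S"
  using M_in_S[of v] by auto

lemma not_in_S': "x \<in> M v \<Longrightarrow> y \<in> M v \<Longrightarrow> x \<noteq> y \<Longrightarrow> v \<notin> S"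
  using M_in_S[of v] by auto

text \<open>The four sets remove at most \<open>4 * low_bound\<close> elements from
  \<open>S\<close>. By \<open>S_large\<close> at least \<open>l\<close> remain, and they are
  isolated from the path.\<close>

lemma no_low_P4:
  assumes "adj a b" "adj b c" "adj c d" "\<not> adj a c" "\<not> adj a d" "\<not> adj b d"
    and low: "low a" "low b" "low c" "low d"
  shows False
proof -
  let ?U = "M a \<union> M b \<union> M c \<union> M d"
  have "card ?U \<le> card (M a) + card (M b) + card (M c) + card (M d)"
    using card_Un_le[of "M a" "M b"] card_Un_le[of "M a \<union> M b" "M c"]
      card_Un_le[of "M a \<union> M b \<union> M c" "M d"] by linarith
  also have "\<dots> \<le> 4 * low_bound" using low by (auto simp: low_def)
  finally have "card ?U \<le> 4 * low_bound" .
  moreover have "card S - card ?U \<le> card (S - ?U)"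
    by (rule diff_card_le_card_Diff) (simp add: finite_M)
  ultimately have "l \<le> card (S - ?U)" using S_large by linarith
  moreover have "card (S - ?U) < l"
  proof (rule P4_free[OF assms(1-6)])
    show "S - ?U \<subseteq> V" using S_subset by blast
    show "independent adj (S - ?U)" using S_indep by (auto simp: independent_def)
    show "\<not> adj w a \<and> \<not> adj w b \<and> \<not> adj w c \<and> \<not> adj w d" if "w \<in> S - ?U" for w
      using that adj_sym by (auto simp: M_def)
  qed
  ultimately show False by simp
qed

text \<open>Otherwise \<open>s\<close>, \<open>u\<close>, \<open>v\<close>, \<open>s'\<close> with
  \<open>s\<close> in \<open>M u\<close> and \<open>s'\<close> in \<open>M v\<close> is an induced
  path of low vertices.\<close>

lemma low_adj_meet:
  assumes "low u" "low v" "adj u v" shows "M u \<inter> M v \<noteq> {}"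
proof
  assume disj: "M u \<inter> M v = {}"
  obtain s s' where s: "s \<in> M u" "s' \<in> M v"
    using assms M_nonempty by (fastforce simp: low_def)
  then have S: "s \<in> S" "s' \<in> S" using M_subset by auto
  have "u \<notin> S" "v \<notin> S"
    using disj assms(3) adj_sym by (auto simp: M_def)
  then have "adj s u" "adj v s'" using s M_adj adj_sym by blast+
  moreover have "\<not> adj s v" "\<not> adj u s'"
    using disj s S adj_sym in_M_if_adj by blast+
  ultimately show False
    using no_low_P4[of s u v s'] assms low_S S independentD[OF S_indep] by blast
qed

text \<open>With \<open>x\<close> private to \<open>u\<close>, \<open>s\<close> private to
  \<open>v\<close> and \<open>y\<close> common, the induced path is \<open>x\<close>,
  \<open>u\<close>, \<open>v\<close>, \<open>s\<close> if \<open>u\<close> and \<open>v\<close> are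
  adjacent, and \<open>x\<close>, \<open>u\<close>, \<open>y\<close>, \<open>v\<close> if
  not.\<close>

lemma low_meet_comparable:
  assumes "low u" "low v" "M u \<inter> M v \<noteq> {}" shows "M u \<subseteq> M v \<or> M v \<subseteq> M u"
proof (rule ccontr)
  assume "\<not> ?thesis"
  then obtain x y s where x: "x \<in> M u" "x \<notin> M v" and y: "y \<in> M u" "y \<in> M v"
    and s: "s \<in> M v" "s \<notin> M u" using assms(3) by blast
  then have S: "x \<in> S" "y \<in> S" "s \<in> S" using M_subset by auto
  have "u \<notin> S" "v \<notin> S" using x y s not_in_S' by metis+
  then have adj: "adj u x" "adj u y" "adj v y" "adj v s" "\<not> adj v x" "\<not> adj u s"
    using x y s M_adj in_M_if_adj S by blast+
  have "adj u v \<Longrightarrow> False"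
    using no_low_P4[of x u v s] adj adj_sym assms low_S S independentD[OF S_indep] by blast
  moreover have "\<not> adj u v \<Longrightarrow> False"
    using no_low_P4[of x u y v] adj adj_sym assms low_S S independentD[OF S_indep] by blast
  ultimately show False by blast
qed

lemma low_adj_comparable:
  "low u \<Longrightarrow> low v \<Longrightarrow> adj u v \<Longrightarrow> M u \<subseteq> M v \<or> M v \<subseteq> M u"
  using low_adj_meet low_meet_comparable by blast

text \<open>If \<open>u\<close> and \<open>v\<close> were not adjacent, then \<open>u\<close>,
  \<open>s\<close>, \<open>v\<close>, \<open>s'\<close> would be an induced path, with
  \<open>s\<close> common and \<open>s'\<close> in \<open>M v\<close> only.\<close>

lemma low_subset_adj:
  assumes "low u" "low v" "M u \<subset> M v" shows "adj u v"
proof (rule ccontr)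
  assume nadj: "\<not> adj u v"
  obtain s s' where s: "s \<in> M u" "s \<in> M v" "s' \<in> M v" "s' \<notin> M u"
    using assms M_nonempty by (fastforce simp: low_def)
  then have S: "s \<in> S" "s' \<in> S" using M_subset by auto
  have v: "v \<notin> S" using s not_in_S' by metis
  have u: "u \<notin> S"
  proof
    assume "u \<in> S"
    then have "u \<in> M v" using assms(3) M_in_S by blast
    then show False using nadj M_adj[OF _ v] adj_sym by blast
  qed
  show False
    using no_low_P4[of u s v s'] s S u v nadj M_adj in_M_if_adj adj_sym assms low_S
      independentD[OF S_indep] by metis
qed

section \<open>The pairwise anticomplete parts \<open>K i\<close>\<close>

lemma K_low: "v \<in> K i \<Longrightarrow> low v"
  using low_bound_pos by (auto simp: K_def low_def)

lemma K_subset: "K i \<subseteq> V" by (auto simp: K_def)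

lemma in_K: "i \<in> S \<Longrightarrow> i \<in> K i"
  using S_subset M_in_S by (auto simp: K_def)

lemma K_disjoint: "i \<noteq> j \<Longrightarrow> K i \<inter> K j = {}"
  by (auto simp: K_def)

lemma K_anticomplete: "a \<in> K i \<Longrightarrow> b \<in> K j \<Longrightarrow> i \<noteq> j \<Longrightarrow> \<not> adj a b"
  using low_adj_meet[OF K_low K_low, of a i b j] by (auto simp: K_def)

lemma K_adj: "a \<in> K i \<Longrightarrow> a \<noteq> i \<Longrightarrow> adj a i"
proof -
  assume "a \<in> K i" "a \<noteq> i"
  then have "i \<in> M a" by (simp add: K_def)
  then show "adj a i" using \<open>a \<noteq> i\<close> by (simp add: M_def)
qed

text \<open>Used through its contrapositive, which supplies a vertex \<open>b\<close> with an edge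
  into the inside of \<open>M v\<close> and with fewer than \<open>m\<close>, but some, elements of
  \<open>M b\<close> outside \<open>M v\<close>. Without such \<open>b\<close>, a least
  \<open>M y\<close> inside \<open>M v\<close> with at least two elements indexes a family of parts
  that the recolouring argument rules out.\<close>

lemma no_isolated_part:
  assumes v: "low v" "2 \<le> card (M v)"
    and out: "\<And>b y. low y \<Longrightarrow> M y \<subseteq> M v \<Longrightarrow> b \<in> V \<Longrightarrow> \<not> M b \<subseteq> M v \<Longrightarrow> adj b y \<Longrightarrow>
      m \<le> card (M b - M v)"
  shows False
proof -
  have lowC: "low y" if "y \<in> V" "M y \<subseteq> M v" for y
    using that v card_mono[OF finite_M that(2)] by (simp add: low_def)
  define Y where "Y = {y \<in> V. M y \<subseteq> M v \<and> 2 \<le> card (M y)}"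
  have "v \<in> Y" using v by (simp add: Y_def low_def)
  then obtain y where y: "y \<in> Y" and min: "\<And>z. z \<in> Y \<Longrightarrow> card (M y) \<le> card (M z)"
    using ex_has_least_nat[of "\<lambda>y. y \<in> Y" v "\<lambda>y. card (M y)"] by blast
  then have yV: "y \<in> V" "M y \<subseteq> M v" "2 \<le> card (M y)" by (auto simp: Y_def)
  then have ylow: "low y" using lowC by blast
  have Kadj: "adj a z" if "low z" "a \<in> K i" "i \<in> M z" "j \<in> M z" "i \<noteq> j" for a z i j
  proof (rule low_subset_adj)
    show "low a" using that K_low by blast
    show "M a \<subset> M z" using that by (auto simp: K_def)
  qed fact
  have main: "adj z a'" if i: "i \<in> M y" and j: "j \<in> M y" "j \<noteq> i" and z: "z \<in> V" "z \<notin> K i"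
    and a: "a \<in> K i" "adj z a" and a': "a' \<in> K j" for i j z a a'
  proof (cases "M z \<subseteq> M v")
    \<comment> \<open>Laminarity and the minimality of \<open>M y\<close> force
      \<open>M y \<subseteq> M z\<close>, so \<open>z\<close> is complete to
      \<open>K j\<close>.\<close>
    case True
    then have zlow: "low z" using lowC z by blast
    have Ma: "M a = {i}" using a by (simp add: K_def)
    have "i \<in> M z" using low_adj_comparable[OF zlow K_low[OF a(1)] a(2)] Ma M_nonempty[OF z(1)] by auto
    moreover have "M z \<noteq> {i}" using z by (auto simp: K_def)
    ultimately obtain h where h: "i \<in> M z" "h \<in> M z" "h \<noteq> i" by blast
    have "card {i, h} \<le> card (M z)" using h by (intro card_mono finite_M) auto
    then have "z \<in> Y" using h z True by (simp add: Y_def)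
    then have "card (M y) \<le> card (M z)" by (rule min)
    moreover have "M y \<subseteq> M z \<or> M z \<subseteq> M y"
      using low_meet_comparable[OF ylow zlow] i h by blast
    ultimately have "M y \<subseteq> M z" using card_seteq[OF finite_M] by blast
    then show ?thesis using Kadj[OF zlow a' _ h(1)] j adj_sym by blast
  next
    case False
    then have "m \<le> card (M z - M v)"
      using out[of a z] a z K_low i yV by (auto simp: K_def)
    \<comment> \<open>If \<open>z\<close> missed \<open>a'\<close>, then \<open>a'\<close>,
      \<open>y\<close>, \<open>a\<close>, \<open>z\<close> with leaves \<open>M z - M v\<close>
      would be a broom.\<close>
    moreover have "card (M z - M v) < m" if nadj: "\<not> adj z a'"
    proof (rule broom_free[of a' y a z])
      have Ma: "M a = {i}" "M a' = {j}" using a a' by (auto simp: K_def)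
      show "adj a' y" using Kadj[OF ylow a' j(1) i j(2)] .
      show "adj y a" using Kadj[OF ylow a(1) i j(1)] j adj_sym by blast
      show "\<not> adj a' a" using K_anticomplete a a' j by blast
      show "adj a z" "\<not> adj a' z" using a nadj adj_sym by blast+
      show "a' \<noteq> z" using Ma False j yV by auto
      show "M z - M v \<subseteq> V" using M_subset S_subset by blast
      show "independent adj (M z - M v)"
        using independentD[OF S_indep] M_subset by (auto simp: independent_def)
      have "z \<notin> S"
      proof
        assume "z \<in> S"
        then have "z \<in> M a" using a adj_sym in_M_if_adj by blast
        then show False using Ma \<open>z \<in> S\<close> False M_in_S i yV by auto
      qed
      fix w assume w: "w \<in> M z - M v"
      then have "w \<notin> M a'" "w \<notin> M y" "w \<notin> M a" using Ma i j yV by auto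
      then show "\<not> adj w a' \<and> \<not> adj w y \<and> \<not> adj w a \<and> adj w z"
        using w \<open>z \<notin> S\<close> M_adj adj_sym in_M_if_adj M_subset by blast
    qed
    ultimately show ?thesis by linarith
  qed
  show False
  proof (rule no_near_homogeneous_family[of "M y" K 1])
    show "finite (M y)" by (rule finite_M)
    show "K i \<noteq> {}" if "i \<in> M y" for i using that in_K M_subset by blast
    \<comment> \<open>With \<open>e = 1\<close> no exceptions are allowed, and two parts are already
      enough.\<close>
    show "n * (1 - 1) + 1 < card (M y)" using yV by simp
    fix i z a assume "i \<in> M y" "z \<in> V" "z \<notin> K i" "a \<in> K i" "adj z a"
    then have "{j \<in> M y - {i}. \<exists>a\<in>K j. \<not> adj z a} = {}" using main by blast
    then show "card {j \<in> M y - {i}. \<exists>a\<in>K j. \<not> adj z a} < 1" by (metis card.empty zero_less_one)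
  qed (use K_subset K_disjoint in auto)
qed

text \<open>
  A vertex with a middle value of \<^term>\<open>card (M v)\<close> starts a chain \<open>M v\<^sub>0 \<subset> M v\<^sub>1 \<subset> \<dots>\<close>
  in which the cardinalities grow by less than \<open>m\<close>; nested sets give adjacent vertices, so the
  chain becomes too large a clique.
\<close>

lemma no_middle:
  assumes v: "v \<in> V" "2 \<le> card (M v)"
  shows "(n + 1) * gap < card (M v)"
proof (rule ccontr)
  assume small: "\<not> (n + 1) * gap < card (M v)"
  \<comment> \<open>\<open>W\<close> is the clique built so far and \<open>u\<close> the next vertex
    of the chain; \<open>u\<close> itself need not be low, but its bound on
    \<open>card (M u)\<close> makes it so as long as \<open>r \<le> n + 2\<close>.\<close>
  have "\<exists>W u. W \<subseteq> V \<and> finite W \<and> card W = r \<and> (\<forall>x\<in>W. \<forall>y\<in>W. x \<noteq> y \<longrightarrow> adj x y) \<and>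
      (\<forall>x\<in>W. low x \<and> M x \<subset> M u) \<and> u \<in> V \<and> 2 \<le> card (M u) \<and> card (M u) \<le> (n + 1) * gap + r * m"
    if "r \<le> n + 2" for r
    using that
  proof (induction r)
    case 0
    show ?case using v small by (intro exI[of _ "{}"] exI[of _ v]) auto
  next
    case (Suc r)
    then obtain W u where W: "W \<subseteq> V" "finite W" "card W = r" "\<forall>x\<in>W. \<forall>y\<in>W. x \<noteq> y \<longrightarrow> adj x y"
      "\<forall>x\<in>W. low x \<and> M x \<subset> M u"
      and u: "u \<in> V" "2 \<le> card (M u)" "card (M u) \<le> (n + 1) * gap + r * m"
      using Suc.IH[OF Suc_leD[OF Suc.prems]] by (elim exE conjE) (rule that)
    have le: "(n + 1) * gap + r * m \<le> low_bound" "(n + 1) * gap + Suc r * m \<le> low_bound"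
      unfolding low_bound_def using Suc.prems by (intro add_left_mono mult_le_mono1; simp)+
    then have ulow: "low u" using u by (simp add: low_def)
    then obtain b y where y: "low y" "M y \<subseteq> M u"
      and b: "b \<in> V" "\<not> M b \<subseteq> M u" "adj b y" "\<not> m \<le> card (M b - M u)"
      using no_isolated_part[OF ulow u(2)] by blast
    have "card (M b) \<le> card (M u \<union> (M b - M u))" by (intro card_mono) (auto simp: finite_M)
    also have "\<dots> \<le> card (M u) + card (M b - M u)" by (rule card_Un_le)
    finally have cb: "card (M b) \<le> (n + 1) * gap + Suc r * m" using b u by simp
    then have blow: "low b" using b le by (simp add: low_def)
    have "M b \<inter> M u \<noteq> {}" using low_adj_meet[OF blow y(1) b(3)] y by blast
    then have sub: "M u \<subset> M b" using low_meet_comparable[OF blow ulow] b by blast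
    then have "2 \<le> card (M b)" using u psubset_card_mono[OF finite_M sub] by simp
    moreover have "u \<notin> W" using W by blast
    moreover have "adj x u \<and> adj u x" if "x \<in> W" for x
    proof -
      have "low x" "M x \<subset> M u" using W(5) that by simp_all
      then have "adj x u" using low_subset_adj ulow by simp
      then show ?thesis using adj_sym by simp
    qed
    moreover have "\<forall>x\<in>W. low x \<and> M x \<subset> M b" using W sub by blast
    ultimately show ?case using W u(1) ulow b(1) cb sub
      by (intro exI[of _ "insert u W"] exI[of _ b]) simp
  qed
  \<comment> \<open>A clique has at most \<open>n + 1\<close> vertices, so \<open>n + 2\<close>
    steps suffice.\<close>
  from this[of "n + 2"] obtain W where "W \<subseteq> V" "card W = n + 2"
    "\<forall>x\<in>W. \<forall>y\<in>W. x \<noteq> y \<longrightarrow> adj x y" by auto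
  then show False using clique_card_le[of W] by simp
qed

subsection \<open>Vertices with many neighbours\<close>

text \<open>An edge \<open>r p\<close> of \<open>K i\<close> with only \<open>p\<close> adjacent to
  \<open>b\<close> extends by \<open>b\<close> and some \<open>w\<close> in \<open>M b\<close> to an
  induced path. One non-neighbour of \<open>b\<close> from each further incomplete part is isolated
  from it, so there are fewer than \<open>l\<close> of these parts; \<open>i\<close> and
  \<open>w\<close> account for the other two.\<close>

lemma mixed_almost_complete:
  assumes b: "b \<in> V" "2 \<le> card (M b)"
    and i: "i \<in> S" "x \<in> K i" "adj b x" "x' \<in> K i" "\<not> adj b x'"
  shows "card {j \<in> S. \<exists>a\<in>K j. \<not> adj b a} < gap"
proof -
  have bS: "b \<notin> S" using not_in_S b by blast
  have bK: "b \<notin> K j" for j using b by (auto simp: K_def)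
  \<comment> \<open>Since \<open>i\<close> is adjacent to all other vertices of \<open>K i\<close>,
    it serves as \<open>p\<close> or as \<open>r\<close>, according to whether \<open>b\<close> is
    adjacent to \<open>i\<close>.\<close>
  obtain r p where rp: "r \<in> K i" "p \<in> K i" "adj r p" "adj b p" "\<not> adj b r"
  proof (cases "adj b i")
    case True
    then show ?thesis using that[of x' i] i in_K K_adj by metis
  next
    case False
    then show ?thesis using that[of i x] i in_K K_adj adj_sym by metis
  qed
  obtain w where w: "w \<in> M b" "w \<noteq> i"
    using b(2) card_mono[of "{i}" "M b"] by fastforce
  then have wS: "w \<in> S" and bw: "adj b w" using M_subset M_adj bS by blast+
  have wK: "w \<in> K w" using in_K wS .
  define J where "J = {j \<in> S - {i, w}. \<exists>a\<in>K j. \<not> adj b a}"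
  obtain f where f: "\<And>j. j \<in> J \<Longrightarrow> f j \<in> K j \<and> \<not> adj b (f j)"
    unfolding J_def using bchoice[of "{j \<in> S - {i, w}. \<exists>a\<in>K j. \<not> adj b a}" "\<lambda>j a. a \<in> K j \<and> \<not> adj b a"]
    by blast
  have inj: "inj_on f J" using f K_disjoint by (intro inj_onI) (metis disjoint_iff)
  have "card (f ` J) < l"
  proof (rule P4_free[of r p b w])
    show "adj r p" "adj p b" "adj b w" "\<not> adj r b" using rp bw adj_sym by blast+
    show "\<not> adj r w" "\<not> adj p w" using rp wK w K_anticomplete by blast+
    show "f ` J \<subseteq> V" using f K_subset by blast
    show "independent adj (f ` J)"
      unfolding independent_def using f K_anticomplete adj_irrefl by (metis imageE)
    fix a assume "a \<in> f ` J"
    then obtain j where j: "j \<in> J" "a = f j" by blast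
    then have "a \<in> K j" "\<not> adj b a" "j \<noteq> i" "j \<noteq> w" using f by (auto simp: J_def)
    then show "\<not> adj a r \<and> \<not> adj a p \<and> \<not> adj a b \<and> \<not> adj a w"
      using K_anticomplete rp wK adj_sym by blast
  qed
  then have "card J < l" using card_image[OF inj] by simp
  have "{j \<in> S. \<exists>a\<in>K j. \<not> adj b a} \<subseteq> J \<union> {i, w}" by (auto simp: J_def)
  then have "card {j \<in> S. \<exists>a\<in>K j. \<not> adj b a} \<le> card (J \<union> {i, w})"
    using finite_S by (intro card_mono) (auto simp: J_def)
  also have "\<dots> \<le> card J + card {i, w}" by (rule card_Un_le)
  also have "card {i, w} \<le> 2" by (simp add: card_insert_if)
  finally show ?thesis using \<open>card J < l\<close> by (simp add: gap_def)
qed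

text \<open>The path \<open>s\<close>, \<open>b'\<close>, \<open>h\<close>, \<open>b\<close> with
  leaves \<open>M b - M b'\<close> at \<open>b\<close> is a broom, up to the undecided edge between
  \<open>b'\<close> and \<open>b\<close>.\<close>

lemma almost_laminar:
  assumes b: "b \<in> V" "b \<notin> S" and b': "b' \<in> V" "b' \<notin> S"
    and h: "h \<in> M b" "h \<in> M b'" and s: "s \<in> M b'" "s \<notin> M b"
  shows "card (M b - M b') < m"
proof (rule broom_free[of s b' h b])
  have S: "h \<in> S" "s \<in> S" using h s M_subset by blast+
  show "adj s b'" by (rule adj_sym[OF M_adj[OF s(1) b'(2)]])
  show "adj b' h" by (rule M_adj[OF h(2) b'(2)])
  show "adj h b" by (rule adj_sym[OF M_adj[OF h(1) b(2)]])
  show "\<not> adj s h" by (rule independentD[OF S_indep S(2,1)])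
  show "\<not> adj s b" using s S in_M_if_adj adj_sym by blast
  show "s \<noteq> b" using S b by blast
  show "M b - M b' \<subseteq> V" using M_subset S_subset by blast
  show "independent adj (M b - M b')"
    using independentD[OF S_indep] M_subset by (auto simp: independent_def)
  fix w assume w: "w \<in> M b - M b'"
  then have "w \<in> S" using M_subset by blast
  then show "\<not> adj w s \<and> \<not> adj w b' \<and> \<not> adj w h \<and> adj w b"
    using w S M_adj[of w b, OF _ b(2)] in_M_if_adj[of b' w] adj_sym independentD[OF S_indep] by blast
qed

lemma contradiction: False
proof -
  \<comment> \<open>A pure vertex is complete or anticomplete to each part; any other vertex with at
    least two elements in \<open>M b\<close> is mixed on some part.\<close>
  define pure where
    "pure b \<longleftrightarrow> b \<in> V \<and> 2 \<le> card (M b) \<and> (\<forall>i\<in>S. (\<exists>a\<in>K i. adj b a) \<longrightarrow> (\<forall>a\<in>K i. adj b a))" for b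
  \<comment> \<open>\<open>A\<close> is a least \<open>M b0\<close> over pure \<open>b0\<close>, or
    all of \<open>S\<close> if no vertex is pure.\<close>
  obtain A where A: "A \<subseteq> S" "n * (gap - 1) + 1 < card A"
    and pureA: "\<And>b i. pure b \<Longrightarrow> i \<in> A \<Longrightarrow> i \<in> M b \<Longrightarrow> card (A - M b) < gap"
  proof (cases "\<exists>b. pure b")
    case True
    then obtain b0 where b0: "pure b0" and min: "\<And>b. pure b \<Longrightarrow> card (M b0) \<le> card (M b)"
      using ex_has_least_nat[of pure _ "\<lambda>b. card (M b)"] by blast
    show thesis
    proof (rule that[of "M b0"])
      show "M b0 \<subseteq> S" by (rule M_subset)
      have "(n + 1) * gap < card (M b0)" using b0 no_middle by (auto simp: pure_def)
      moreover have "n * (gap - 1) + 1 \<le> (n + 1) * gap"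
        by (simp add: gap_def)
      ultimately show "n * (gap - 1) + 1 < card (M b0)" by linarith
      fix b i assume b: "pure b" and i: "i \<in> M b0" "i \<in> M b"
      show "card (M b0 - M b) < gap"
      proof (cases "M b \<subseteq> M b0")
        case True
        then have "M b = M b0" using card_seteq[OF finite_M True] min[OF b] by blast
        then show ?thesis by (simp add: gap_def)
      next
        case False
        then obtain s where "s \<in> M b" "s \<notin> M b0" by blast
        then have "card (M b0 - M b) < m"
          using almost_laminar[of b0 b i s] i b b0 not_in_S by (auto simp: pure_def)
        then show ?thesis by (simp add: gap_def)
      qed
    qed
  next
    case False
    have "n * (gap - 1) + 1 < 4 * low_bound" by (simp add: low_bound_def gap_def)
    then have "n * (gap - 1) + 1 < card S" using S_large by linarith
    with False show thesis using that[of S] by blast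
  qed
  show False
  proof (rule no_near_homogeneous_family[of A K gap])
    show "finite A" using A finite_S finite_subset by blast
    show "K i \<noteq> {}" if "i \<in> A" for i using that in_K A by blast
    show "n * (gap - 1) + 1 < card A" by (rule A)
    fix i z a assume i: "i \<in> A" and z: "z \<in> V" "z \<notin> K i" and a: "a \<in> K i" "adj z a"
    have iS: "i \<in> S" using i A by blast
    \<comment> \<open>A vertex with singleton \<open>M z\<close> would lie in another part, and
      parts are anticomplete.\<close>
    have zM: "2 \<le> card (M z)"
    proof (rule ccontr)
      assume "\<not> 2 \<le> card (M z)"
      moreover have "card (M z) \<noteq> 0" using M_nonempty[OF z(1)] finite_M by simp
      ultimately have "card (M z) = 1" by linarith
      then obtain j where "M z = {j}" by (auto simp: card_1_singleton_iff)
      then have "z \<in> K j" "j \<noteq> i" using z by (auto simp: K_def)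
      then show False using K_anticomplete a by blast
    qed
    show "card {j \<in> A - {i}. \<exists>a\<in>K j. \<not> adj z a} < gap"
    proof (cases "pure z")
      case True
      \<comment> \<open>Purity carries adjacency from \<open>a\<close> to \<open>i\<close>, so
        \<open>pureA\<close> applies; it also makes \<open>z\<close> complete to \<open>K j\<close>
        for each \<open>j\<close> in \<open>M z\<close>, so that exceptions lie in
        \<open>A - M z\<close>.\<close>
      then have zi: "i \<in> M z" using a iS in_K in_M_if_adj by (fastforce simp: pure_def)
      have "{j \<in> A - {i}. \<exists>a\<in>K j. \<not> adj z a} \<subseteq> A - M z"
        using True A in_K M_adj[OF _ not_in_S[OF zM]] by (fastforce simp: pure_def)
      then have "card {j \<in> A - {i}. \<exists>a\<in>K j. \<not> adj z a} \<le> card (A - M z)"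
        using A finite_S by (intro card_mono) (auto intro: finite_subset)
      then show ?thesis using pureA[OF True i zi] by simp
    next
      case False
      then obtain j x x' where "j \<in> S" "x \<in> K j" "adj z x" "x' \<in> K j" "\<not> adj z x'"
        using z zM by (auto simp: pure_def)
      then have "card {j \<in> S. \<exists>a\<in>K j. \<not> adj z a} < gap"
        using mixed_almost_complete[OF z(1) zM] by blast
      moreover have "card {j \<in> A - {i}. \<exists>a\<in>K j. \<not> adj z a} \<le> card {j \<in> S. \<exists>a\<in>K j. \<not> adj z a}"
        using A finite_S by (intro card_mono) auto
      ultimately show ?thesis by linarith
    qed
  qed (use K_subset K_disjoint in auto)
qed

end

section \<open>Bounds on independent sets and on the order\<close>

context free_critical_graph
begin

text \<open>A larger independent set would extend to an inclusion-maximal one, to which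
  \<open>large_independent_set\<close> applies.\<close>

lemma independent_card_le:
  assumes W: "W \<subseteq> V" "independent adj W"
  shows "card W \<le> 4 * low_bound + l"
proof (rule ccontr)
  assume large: "\<not> ?thesis"
  let ?P = "\<lambda>T. W \<subseteq> T \<and> T \<subseteq> V \<and> independent adj T"
  have "finite {T. ?P T}" using finite_V by (auto intro: finite_subset[of _ "Pow V"])
  moreover have "W \<in> {T. ?P T}" using W by simp
  ultimately obtain S where S: "S \<in> {T. ?P T}" and "\<forall>T\<in>{T. ?P T}. S \<subseteq> T \<longrightarrow> S = T"
    using finite_has_maximal[of "{T. ?P T}"] by blast
  then have S: "?P S" and max: "?P T \<Longrightarrow> S \<subseteq> T \<Longrightarrow> S = T" for T by simp_all
  have "large_independent_set V adj n l m S"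
  proof (unfold_locales)
    show "S \<subseteq> V" "independent adj S" using S by auto
    show "\<exists>s\<in>S. adj v s" if "v \<in> V" "v \<notin> S" for v
    proof (rule ccontr)
      assume "\<not> ?thesis"
      then have "?P (insert v S)"
        using S that adj_irrefl adj_sym by (auto simp: independent_def)
      then show False using max that by blast
    qed
    have "card W \<le> card S" using S finite_V by (meson card_mono finite_subset)
    then show "4 * low_bound + l \<le> card S" using large by simp
  qed
  then show False by (rule large_independent_set.contradiction)
qed

lemma card_V_le: "card V \<le> n * (4 * low_bound + l) + 1"
  using card_le_of_independent_bound[of "4 * low_bound + l"] independent_card_le by simp

end


subsection \<open>Induced copies of the forbidden graphs\<close>

text \<open>The image of \<open>H\<close> under \<open>f\<close> is isomorphic to \<open>H\<close>,
  and the equivalence on arcs makes it an induced subgraph of \<open>G\<close>.\<close>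

lemma no_induced_copy:
  assumes free: "induced_free (with_proj H) (with_proj G)"
    and H: "pair_wf_digraph H" and G: "pair_wf_digraph G"
    and f: "inj_on f (pverts H)" "f ` pverts H \<subseteq> pverts G"
    and arcs: "\<And>u v. u \<in> pverts H \<Longrightarrow> v \<in> pverts H \<Longrightarrow> (u, v) \<in> parcs H \<longleftrightarrow> (f u, f v) \<in> parcs G"
  shows False
proof -
  interpret H: pair_wf_digraph H by fact
  let ?F = "\<lparr> pverts = f ` pverts H, parcs = map_prod f f ` parcs H \<rparr>"
  have parcs_F: "parcs ?F = {e \<in> parcs G. fst e \<in> pverts ?F \<and> snd e \<in> pverts ?F}"
  proof
    show "parcs ?F \<subseteq> {e \<in> parcs G. fst e \<in> pverts ?F \<and> snd e \<in> pverts ?F}"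
    proof
      fix e assume "e \<in> parcs ?F"
      then obtain u v where e: "(u, v) \<in> parcs H" "e = map_prod f f (u, v)" by auto
      then have "u \<in> pverts H" "v \<in> pverts H" by (auto dest: H.in_arcsD1 H.in_arcsD2)
      then show "e \<in> {e \<in> parcs G. fst e \<in> pverts ?F \<and> snd e \<in> pverts ?F}"
        using e arcs by simp
    qed
    show "{e \<in> parcs G. fst e \<in> pverts ?F \<and> snd e \<in> pverts ?F} \<subseteq> parcs ?F"
    proof
      fix e assume "e \<in> {e \<in> parcs G. fst e \<in> pverts ?F \<and> snd e \<in> pverts ?F}"
      then obtain u v where uv: "u \<in> pverts H" "v \<in> pverts H" "e = map_prod f f (u, v)"
        and e: "e \<in> parcs G" by (cases e) auto
      then have "(u, v) \<in> parcs H" using arcs by simp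
      then show "e \<in> parcs ?F" unfolding uv(3) by (simp only: pair_pre_digraph.simps imageI)
    qed
  qed
  have F: "pair_wf_digraph ?F"
    by unfold_locales (auto dest: H.in_arcsD1 H.in_arcsD2)
  have "digraph_iso (with_proj H) (with_proj ?F)"
    unfolding digraph_iso_pair_iff[OF H] using f(1) by (intro exI[of _ f]) simp
  then have "digraph_iso (with_proj ?F) (with_proj H)"
    by (rule digraph_iso_swap[rotated]) (rule H.wf_digraph)
  moreover have "induced_subgraph (with_proj ?F) (with_proj G)"
    using parcs_F f(2) F G
    by (auto simp: induced_subgraph_def subgraph_def wf_digraph_wp_iff)
  ultimately show False using free by (auto simp: induced_free_def)
qed

text \<open>Otherwise the vertices below 4 could be sent to \<open>xs\<close> and the other
  \<open>q\<close> injectively into \<open>W\<close>. As \<open>leaf\<close> treats all elements of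
  \<open>W\<close> alike, any \<open>q\<close> of them serve.\<close>

lemma card_lt_if_induced_free:
  assumes free: "induced_free (with_proj H) (with_proj G)"
    and H: "pair_graph H" "pverts H = {..<4 + q}" and G: "pair_graph G"
    and xs: "distinct xs" "length xs = 4" "set xs \<subseteq> pverts G"
    and W: "W \<subseteq> pverts G" "independent (\<lambda>u v. (u, v) \<in> parcs G) W" "W \<inter> set xs = {}"
    and core: "\<And>i j. i < 4 \<Longrightarrow> j < 4 \<Longrightarrow> (i, j) \<in> parcs H \<longleftrightarrow> (xs ! i, xs ! j) \<in> parcs G"
    and leaf: "\<And>i j w. i < 4 \<Longrightarrow> 4 \<le> j \<Longrightarrow> j < 4 + q \<Longrightarrow> w \<in> W \<Longrightarrow>
        (i, j) \<in> parcs H \<longleftrightarrow> (xs ! i, w) \<in> parcs G"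
    and leaves: "\<And>i j. 4 \<le> i \<Longrightarrow> 4 \<le> j \<Longrightarrow> (i, j) \<notin> parcs H"
  shows "card W < q"
proof (rule ccontr)
  interpret H: pair_graph H by fact
  interpret G: pair_graph G by fact
  assume "\<not> card W < q"
  then obtain W' where W': "W' \<subseteq> W" "finite W'" "card W' = q"
    by (meson not_less obtain_subset_with_card_n)
  then obtain g where g: "bij_betw g {0..<q} W'"
    using ex_bij_betw_nat_finite by blast
  let ?f = "\<lambda>i. if i < 4 then xs ! i else g (i - 4)"
  have symH: "(u, v) \<in> parcs H \<longleftrightarrow> (v, u) \<in> parcs H" for u v
    using H.arcs_symmetric by blast
  have symG: "(u, v) \<in> parcs G \<longleftrightarrow> (v, u) \<in> parcs G" for u v
    using G.arcs_symmetric by blast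
  have gW: "g (i - 4) \<in> W" if "4 \<le> i" "i < 4 + q" for i
    using bij_betwE[OF g] W' that by auto
  have gneq: "g (i - 4) \<noteq> xs ! j" if "4 \<le> i" "i < 4 + q" "j < 4" for i j
    using gW[OF that(1,2)] W(3) that(3) xs(2) nth_mem by fastforce
  have ginj: "i = j" if "g (i - 4) = g (j - 4)" "4 \<le> i" "i < 4 + q" "4 \<le> j" "j < 4 + q" for i j
  proof -
    have "i - 4 = j - 4"
      using that bij_betw_imp_inj_on[OF g] by (auto simp: inj_on_def)
    then show ?thesis using that by simp
  qed
  show False
  proof (rule no_induced_copy[OF free H.pair_wf_digraph G.pair_wf_digraph, of ?f])
    show "inj_on ?f (pverts H)"
    proof (rule inj_onI)
      fix i j assume "i \<in> pverts H" "j \<in> pverts H" and eq: "?f i = ?f j"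
      then have ij: "i < 4 + q" "j < 4 + q" using H(2) by auto
      show "i = j"
        using eq ij ginj[of i j] gneq[of i j] gneq[of j i] xs(1,2)
        by (cases "i < 4"; cases "j < 4") (auto simp: nth_eq_iff_index_eq)
    qed
    show "?f ` pverts H \<subseteq> pverts G"
      using gW W(1) xs(2,3) H(2) by (auto simp: not_less)
    fix i j assume "i \<in> pverts H" "j \<in> pverts H"
    then have ij: "i < 4 + q" "j < 4 + q" using H(2) by auto
    show "(i, j) \<in> parcs H \<longleftrightarrow> (?f i, ?f j) \<in> parcs G"
    proof (cases "i < 4"; cases "j < 4")
      assume "i < 4" "j < 4"
      then show ?thesis using core by simp
    next
      assume "i < 4" "\<not> j < 4"
      then show ?thesis using leaf[of i j] gW[of j] ij by simp
    next
      assume "\<not> i < 4" "j < 4"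
      then show ?thesis
        using leaf[of j i] gW[of i] ij symH[of i j] symG[of "g (i - 4)"] by simp
    next
      assume "\<not> i < 4" "\<not> j < 4"
      then show ?thesis
        using leaves[of i j] gW[of i] gW[of j] ij independentD[OF W(2)] by simp
    qed
  qed
qed

lemma symcl_iff: "(u, v) \<in> R\<^sup>s \<longleftrightarrow> (u, v) \<in> R \<or> (v, u) \<in> R"
  by (force simp: symcl_def)

lemma less_4_cases: "(i::nat) < 4 \<Longrightarrow> i = 0 \<or> i = 1 \<or> i = 2 \<or> i = 3"
  by auto

text \<open>These bounds provide the assumptions of \<open>free_critical_graph\<close>. The core
  \<open>a\<close>, \<open>b\<close>, \<open>c\<close>, \<open>d\<close> is always the image of 0,
  1, 2, 3; in \<open>B3_plus\<close> the leaves hang at \<open>c\<close>, and \<open>d\<close> is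
  the added tip of the triangle.\<close>

lemma (in pair_graph) forbidden_bounds:
  fixes W :: "'a set"
  defines "adj \<equiv> \<lambda>u v. (u, v) \<in> parcs G"
  assumes W: "W \<subseteq> pverts G" "independent adj W"
  shows P4_bound: "\<lbrakk>induced_free (with_proj (P4_plus_P1s l)) (with_proj G);
      adj a b; adj b c; adj c d; \<not> adj a c; \<not> adj a d; \<not> adj b d;
      \<And>w. w \<in> W \<Longrightarrow> \<not> adj w a \<and> \<not> adj w b \<and> \<not> adj w c \<and> \<not> adj w d\<rbrakk> \<Longrightarrow> card W < l"
    and B4_bound: "\<lbrakk>induced_free (with_proj (B4 m)) (with_proj G);
      adj a b; adj b c; adj c d; \<not> adj a c; \<not> adj a d; \<not> adj b d;
      \<And>w. w \<in> W \<Longrightarrow> \<not> adj w a \<and> \<not> adj w b \<and> \<not> adj w c \<and> adj w d\<rbrakk> \<Longrightarrow> card W < m"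
    and B3_plus_bound: "\<lbrakk>induced_free (with_proj (B3_plus m)) (with_proj G);
      adj a b; adj b c; adj b d; adj c d; \<not> adj a c; \<not> adj a d;
      \<And>w. w \<in> W \<Longrightarrow> \<not> adj w a \<and> \<not> adj w b \<and> adj w c \<and> \<not> adj w d\<rbrakk> \<Longrightarrow> card W < m"
proof -
  have G: "pair_graph G" by unfold_locales
  have sym: "(u, v) \<in> parcs G \<longleftrightarrow> (v, u) \<in> parcs G" for u v
    using arcs_symmetric by blast
  have irrefl: "(u, u) \<notin> parcs G" for u using pair_no_loops[of "(u, u)"] by auto
  have V: "u \<in> pverts G" "v \<in> pverts G" if "(u, v) \<in> parcs G" for u v
    using that in_arcsD1 in_arcsD2 by auto
  note W' = W[unfolded adj_def]
  { assume free: "induced_free (with_proj (P4_plus_P1s l)) (with_proj G)"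
      and path: "adj a b" "adj b c" "adj c d" "\<not> adj a c" "\<not> adj a d" "\<not> adj b d"
      and w: "\<And>w. w \<in> W \<Longrightarrow> \<not> adj w a \<and> \<not> adj w b \<and> \<not> adj w c \<and> \<not> adj w d"
    have path': "(b, a) \<in> parcs G" "(c, b) \<in> parcs G" "(d, c) \<in> parcs G"
      "(c, a) \<notin> parcs G" "(d, a) \<notin> parcs G" "(d, b) \<notin> parcs G"
      using path sym unfolding adj_def by blast+
    note facts = path[unfolded adj_def] path' irrefl
    have w': "(x, a) \<notin> parcs G" "(a, x) \<notin> parcs G"
      "(x, b) \<notin> parcs G" "(b, x) \<notin> parcs G"
      "(x, c) \<notin> parcs G" "(c, x) \<notin> parcs G"
      "(x, d) \<notin> parcs G" "(d, x) \<notin> parcs G" if "x \<in> W" for x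
      using w[OF that] sym unfolding adj_def by blast+
    show "card W < l"
    proof (rule card_lt_if_induced_free[where xs = "[a, b, c, d]", OF free pair_graph_forbidden(1) _ G _ _ _ W'])
      show "distinct [a, b, c, d]" using facts by auto
      show "set [a, b, c, d] \<subseteq> pverts G" using facts V by auto
      show "W \<inter> set [a, b, c, d] = {}" using facts w' by auto
    next
      fix i j :: nat assume "i < 4" "j < 4"
      then show "(i, j) \<in> parcs (P4_plus_P1s l) \<longleftrightarrow> ([a, b, c, d] ! i, [a, b, c, d] ! j) \<in> parcs G"
        by (elim less_4_cases[THEN disjE] disjE; hypsubst) (simp_all add: P4_plus_P1s_def symcl_iff facts)
    next
      fix i j :: nat and x assume "i < 4" "4 \<le> j" "x \<in> W"
      then show "(i, j) \<in> parcs (P4_plus_P1s l) \<longleftrightarrow> ([a, b, c, d] ! i, x) \<in> parcs G"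
        by (elim less_4_cases[THEN disjE] disjE; hypsubst) (auto simp: P4_plus_P1s_def symcl_iff w')
    qed (auto simp: P4_plus_P1s_def symcl_iff) }
  { assume free: "induced_free (with_proj (B4 m)) (with_proj G)"
      and path: "adj a b" "adj b c" "adj c d" "\<not> adj a c" "\<not> adj a d" "\<not> adj b d"
      and w: "\<And>w. w \<in> W \<Longrightarrow> \<not> adj w a \<and> \<not> adj w b \<and> \<not> adj w c \<and> adj w d"
    have path': "(b, a) \<in> parcs G" "(c, b) \<in> parcs G" "(d, c) \<in> parcs G"
      "(c, a) \<notin> parcs G" "(d, a) \<notin> parcs G" "(d, b) \<notin> parcs G"
      using path sym unfolding adj_def by blast+
    note facts = path[unfolded adj_def] path' irrefl
    have w': "(x, a) \<notin> parcs G" "(a, x) \<notin> parcs G"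
      "(x, b) \<notin> parcs G" "(b, x) \<notin> parcs G"
      "(x, c) \<notin> parcs G" "(c, x) \<notin> parcs G"
      "(x, d) \<in> parcs G" "(d, x) \<in> parcs G" if "x \<in> W" for x
      using w[OF that] sym unfolding adj_def by blast+
    show "card W < m"
    proof (rule card_lt_if_induced_free[where xs = "[a, b, c, d]", OF free pair_graph_forbidden(2) _ G _ _ _ W'])
      show "distinct [a, b, c, d]" using facts by auto
      show "set [a, b, c, d] \<subseteq> pverts G" using facts V by auto
      show "W \<inter> set [a, b, c, d] = {}" using facts w' by auto
    next
      fix i j :: nat assume "i < 4" "j < 4"
      then show "(i, j) \<in> parcs (B4 m) \<longleftrightarrow> ([a, b, c, d] ! i, [a, b, c, d] ! j) \<in> parcs G"
        by (elim less_4_cases[THEN disjE] disjE; hypsubst) (simp_all add: B4_def symcl_iff facts)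
    next
      fix i j :: nat and x assume "i < 4" "4 \<le> j" "j < 4 + m" "x \<in> W"
      then show "(i, j) \<in> parcs (B4 m) \<longleftrightarrow> ([a, b, c, d] ! i, x) \<in> parcs G"
        by (elim less_4_cases[THEN disjE] disjE; hypsubst) (auto simp: B4_def symcl_iff w')
    qed (auto simp: B4_def symcl_iff) }
  { assume free: "induced_free (with_proj (B3_plus m)) (with_proj G)"
      and path: "adj a b" "adj b c" "adj b d" "adj c d" "\<not> adj a c" "\<not> adj a d"
      and w: "\<And>w. w \<in> W \<Longrightarrow> \<not> adj w a \<and> \<not> adj w b \<and> adj w c \<and> \<not> adj w d"
    have path': "(b, a) \<in> parcs G" "(c, b) \<in> parcs G" "(d, b) \<in> parcs G"
      "(d, c) \<in> parcs G" "(c, a) \<notin> parcs G" "(d, a) \<notin> parcs G"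
      using path sym unfolding adj_def by blast+
    note facts = path[unfolded adj_def] path' irrefl
    have w': "(x, a) \<notin> parcs G" "(a, x) \<notin> parcs G"
      "(x, b) \<notin> parcs G" "(b, x) \<notin> parcs G"
      "(x, c) \<in> parcs G" "(c, x) \<in> parcs G"
      "(x, d) \<notin> parcs G" "(d, x) \<notin> parcs G" if "x \<in> W" for x
      using w[OF that] sym unfolding adj_def by blast+
    show "card W < m"
    proof (rule card_lt_if_induced_free[where xs = "[a, b, c, d]", OF free pair_graph_forbidden(3) _ G _ _ _ W'])
      show "distinct [a, b, c, d]" using facts by auto
      show "set [a, b, c, d] \<subseteq> pverts G" using facts V by auto
      show "W \<inter> set [a, b, c, d] = {}" using facts w' by auto
    next
      fix i j :: nat assume "i < 4" "j < 4"
      then show "(i, j) \<in> parcs (B3_plus m) \<longleftrightarrow> ([a, b, c, d] ! i, [a, b, c, d] ! j) \<in> parcs G"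
        by (elim less_4_cases[THEN disjE] disjE; hypsubst) (simp_all add: B3_plus_def symcl_iff facts)
    next
      fix i j :: nat and x assume "i < 4" "4 \<le> j" "j < 4 + m" "x \<in> W"
      then show "(i, j) \<in> parcs (B3_plus m) \<longleftrightarrow> ([a, b, c, d] ! i, x) \<in> parcs G"
        by (elim less_4_cases[THEN disjE] disjE; hypsubst) (auto simp: B3_plus_def symcl_iff w')
    qed (auto simp: B3_plus_def symcl_iff) }
qed

subsection \<open>Critical graphs of bounded order\<close>

lemma colourable_with_proj_iff:
  assumes "pair_graph G"
  shows "colourable (with_proj G) q \<longleftrightarrow>
    (\<exists>c. proper_colouring (\<lambda>u v. (u, v) \<in> parcs G) (pverts G) c \<and> c ` pverts G \<subseteq> {..<q})"
proof -
  interpret pair_graph G by fact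
  have "proper_colouring (\<lambda>u v. (u, v) \<in> parcs G) (pverts G) c \<longleftrightarrow>
      (\<forall>u v. (u, v) \<in> parcs G \<longrightarrow> c u \<noteq> c v)" for c
    using in_arcsD1 in_arcsD2 by (fastforce simp: proper_colouring_def)
  then show ?thesis by (simp add: colourable_def image_subset_iff Ball_def conj_commute)
qed

lemma colourable_del_vert_iff:
  assumes "pair_graph G"
  shows "colourable (pre_digraph.del_vert (with_proj G) x) q \<longleftrightarrow>
    (\<exists>c. proper_colouring (\<lambda>u v. (u, v) \<in> parcs G) (pverts G - {x}) c
      \<and> c ` (pverts G - {x}) \<subseteq> {..<q})"
proof -
  interpret pair_graph G by fact
  have "arcs_ends (pre_digraph.del_vert (with_proj G) x) = {(u, v) \<in> parcs G. u \<noteq> x \<and> v \<noteq> x}"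
    by (auto simp: arcs_ends_def arc_to_ends_def del_vert_simps)
  moreover have "proper_colouring (\<lambda>u v. (u, v) \<in> parcs G) (pverts G - {x}) c \<longleftrightarrow>
      (\<forall>u v. (u, v) \<in> parcs G \<and> u \<noteq> x \<and> v \<noteq> x \<longrightarrow> c u \<noteq> c v)" for c
    using in_arcsD1 in_arcsD2 by (fastforce simp: proper_colouring_def)
  ultimately show ?thesis
    by (simp add: colourable_def image_subset_iff Ball_def conj_commute verts_del_vert)
qed

lemma colourable_mono: "colourable G p \<Longrightarrow> p \<le> q \<Longrightarrow> colourable G q"
  unfolding colourable_def by (meson order_less_le_trans)

lemma critical_graph_if_vertex_critical:
  assumes crit: "vertex_critical k (with_proj G)" and k: "k \<ge> 1"
  shows "critical_graph (pverts G) (\<lambda>u v. (u, v) \<in> parcs G) (k - 1)"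
proof -
  have G: "pair_graph G" using crit unfolding vertex_critical_def by (intro pair_graphI_graph) blast
  interpret pair_graph G by fact
  show ?thesis
  proof
    show "finite (pverts G)" by (rule pair_finite_verts)
    show "u \<in> pverts G" if "(u, v) \<in> parcs G" for u v using that in_arcsD1 by auto
    show "(v, u) \<in> parcs G" if "(u, v) \<in> parcs G" for u v using that arcs_symmetric by auto
    show "(u, u) \<notin> parcs G" for u using pair_no_loops[of "(u, u)"] by auto
    have "k - 1 < chromatic_number (with_proj G)" using crit k by (auto simp: vertex_critical_def)
    then have "\<not> colourable (with_proj G) (k - 1)"
      unfolding chromatic_number_def by (rule not_less_Least)
    then show "\<not> (\<exists>c. proper_colouring (\<lambda>u v. (u, v) \<in> parcs G) (pverts G) c
        \<and> c ` pverts G \<subseteq> {..<k - 1})"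
      using colourable_with_proj_iff[OF G] by blast
    fix x assume x: "x \<in> pverts G"
    let ?D = "pre_digraph.del_vert (with_proj G) x"
    \<comment> \<open>Some colouring of the deleted graph must be exhibited before the
      \<open>LEAST\<close> in its chromatic number is known to be attained.\<close>
    obtain c where "proper_colouring (\<lambda>u v. (u, v) \<in> parcs G) (pverts G) c"
      "c ` pverts G \<subseteq> {..<card (pverts G)}"
      using colourable_order colourable_with_proj_iff[OF G] by auto
    then have "proper_colouring (\<lambda>u v. (u, v) \<in> parcs G) (pverts G - {x}) c"
      "c ` (pverts G - {x}) \<subseteq> {..<card (pverts G)}"
      using proper_colouring_subset[of _ "pverts G" c] by auto
    then have "colourable ?D (card (pverts G))"
      unfolding colourable_del_vert_iff[OF G] by (intro exI[of _ c] conjI)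
    then have "colourable ?D (chromatic_number ?D)"
      unfolding chromatic_number_def by (rule LeastI)
    moreover have "chromatic_number ?D \<le> k - 1" using crit x by (fastforce simp: vertex_critical_def)
    ultimately have "colourable ?D (k - 1)" by (rule colourable_mono)
    then show "\<exists>c. proper_colouring (\<lambda>u v. (u, v) \<in> parcs G) (pverts G - {x}) c
        \<and> c ` (pverts G - {x}) \<subseteq> {..<k - 1}"
      using colourable_del_vert_iff[OF G] by blast
  qed
qed

section \<open>Finitely many isomorphism classes of bounded order\<close>

lemma finite_up_to_iso_if_card_le:
  fixes \<G> :: "'a pair_pre_digraph set"
  assumes "\<And>G. G \<in> \<G> \<Longrightarrow> pair_graph G" "\<And>G. G \<in> \<G> \<Longrightarrow> card (pverts G) \<le> N"
  shows "finite_up_to_iso \<G>"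
proof -
  \<comment> \<open>An arbitrary numbering of the vertices suffices: isomorphic graphs may get
    different codes, but equal codes give isomorphic graphs, by composing one numbering with the
    inverse of the other.\<close>
  define num where "num G = (SOME f. bij_betw f (pverts G) {0..<card (pverts G)})"
    for G :: "'a pair_pre_digraph"
  define code where "code G = (num G ` pverts G, map_prod (num G) (num G) ` parcs G)"
    for G :: "'a pair_pre_digraph"
  have num: "bij_betw (num G) (pverts G) {0..<card (pverts G)}" if "pair_graph G" for G
  proof -
    interpret pair_graph G by fact
    show ?thesis unfolding num_def
      using ex_bij_betw_finite_nat[OF pair_finite_verts] by (rule someI_ex)
  qed
  have arcs: "parcs G \<subseteq> pverts G \<times> pverts G" if "pair_graph G" for G :: "'a pair_pre_digraph"
  proof -
    interpret pair_graph G by fact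
    show ?thesis using in_arcsD1 in_arcsD2 by auto
  qed
  have "code ` \<G> \<subseteq> Pow {..<N} \<times> Pow ({..<N} \<times> {..<N})"
  proof
    fix x assume "x \<in> code ` \<G>"
    then obtain G where G: "G \<in> \<G>" "x = code G" by blast
    have "num G ` pverts G \<subseteq> {..<N}"
      using bij_betwE[OF num[OF assms(1)[OF G(1)]]] assms(2)[OF G(1)] by fastforce
    then show "x \<in> Pow {..<N} \<times> Pow ({..<N} \<times> {..<N})"
      using arcs[OF assms(1)[OF G(1)]] unfolding G(2) code_def by fastforce
  qed
  then have fin: "finite (code ` \<G>)" by (rule finite_subset) auto
  have iso: "(G, H) \<in> graph_iso_rel" if "G \<in> \<G>" "H \<in> \<G>" and eq: "code G = code H" for G H
  proof -
    have G: "pair_graph G" and H: "pair_graph H" using that assms by auto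
    let ?g = "the_inv_into (pverts H) (num H)"
    have inj: "inj_on (num G) (pverts G)" "inj_on (num H) (pverts H)"
      using num G H bij_betw_imp_inj_on by blast+
    have V: "num G ` pverts G = num H ` pverts H"
      and E: "map_prod (num G) (num G) ` parcs G = map_prod (num H) (num H) ` parcs H"
      using eq by (auto simp: code_def)
    have "inj_on (?g \<circ> num G) (pverts G)"
      by (intro comp_inj_on inj) (simp add: V inj inj_on_the_inv_into)
    moreover have "pverts H = (?g \<circ> num G) ` pverts G"
      unfolding image_comp[symmetric] V using inj by (simp add: the_inv_into_onto)
    moreover have "parcs H = map_prod (?g \<circ> num G) (?g \<circ> num G) ` parcs G"
    proof -
      have "map_prod (?g \<circ> num G) (?g \<circ> num G) ` parcs G
          = map_prod ?g ?g ` map_prod (num H) (num H) ` parcs H"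
        unfolding E[symmetric] by (simp add: image_comp map_prod_compose)
      also have "\<dots> = (\<lambda>e. e) ` parcs H"
        unfolding image_image using arcs[OF H] inj
        by (intro image_cong) (auto simp: the_inv_into_f_f)
      finally show ?thesis by simp
    qed
    moreover have "pair_wf_digraph G"
      by (rule pair_digraph.pair_wf_digraph[OF pair_graph.axioms(1)[OF G]])
    ultimately show ?thesis
      using G H by (auto simp only: graph_iso_rel_def digraph_iso_pair_iff mem_Collect_eq case_prod_conv)
  qed
  let ?r = "\<lambda>G. graph_iso_rel `` {G}"
  have "\<G> // graph_iso_rel = ?r ` \<G>" by (auto simp: quotient_def)
  \<comment> \<open>Each class is recovered from the code of any of its members in
    \<open>\<G>\<close>, so there are at most as many classes as codes.\<close>
  also have "\<dots> \<subseteq> (\<lambda>x. ?r (SOME G. G \<in> \<G> \<and> code G = x)) ` code ` \<G>"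
  proof
    fix X assume "X \<in> ?r ` \<G>"
    then obtain G where G: "G \<in> \<G>" "X = ?r G" by blast
    let ?H = "SOME H. H \<in> \<G> \<and> code H = code G"
    have "?H \<in> \<G> \<and> code ?H = code G" by (rule someI) (use G in simp)
    then have "(G, ?H) \<in> graph_iso_rel" using iso G by simp
    then have "X = ?r ?H" using G equiv_class_eq[OF equiv_graph_iso_rel] by blast
    then show "X \<in> (\<lambda>x. ?r (SOME G. G \<in> \<G> \<and> code G = x)) ` code ` \<G>" using G by blast
  qed
  finally show ?thesis
    unfolding finite_up_to_iso_def using fin finite_surj by blast
qed

theorem theorem1:
  fixes k l m :: nat
  assumes "k \<ge> 1"
  shows "finite_up_to_iso {G :: 'a pair_pre_digraph.
           vertex_critical k (with_proj G)
           \<and> induced_free (with_proj (P4_plus_P1s l)) (with_proj G)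
           \<and> induced_free (with_proj (B4 m)) (with_proj G)
           \<and> induced_free (with_proj (B3_plus m)) (with_proj G)}"
    (is "finite_up_to_iso ?\<G>")
proof (rule finite_up_to_iso_if_card_le)
  \<comment> \<open>This is the bound of \<open>card_V_le\<close> for \<open>n = k - 1\<close>; it
    depends on \<open>k\<close>, \<open>l\<close> and \<open>m\<close> only.\<close>
  let ?N = "(k - 1) * (4 * free_critical_graph.low_bound (k - 1) l m + l) + 1"
  fix G assume "G \<in> ?\<G>"
  then have crit: "vertex_critical k (with_proj G)"
    and free: "induced_free (with_proj (P4_plus_P1s l)) (with_proj G)"
      "induced_free (with_proj (B4 m)) (with_proj G)"
      "induced_free (with_proj (B3_plus m)) (with_proj G)" by simp_all
  from crit show pg: "pair_graph G"
    unfolding vertex_critical_def by (intro pair_graphI_graph) simp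
  interpret critical_graph "pverts G" "\<lambda>u v. (u, v) \<in> parcs G" "k - 1"
    using crit assms by (rule critical_graph_if_vertex_critical)
  interpret free_critical_graph "pverts G" "\<lambda>u v. (u, v) \<in> parcs G" "k - 1" l m
  proof (unfold_locales, goal_cases)
    case (1 a b c d W)
    show ?case by (rule pair_graph.P4_bound[OF pg 1(7,8) free(1) 1(1-6) 1(9)])
  next
    case (2 a b c d W)
    show ?case by (rule pair_graph.B4_bound[OF pg 2(7,8) free(2) 2(1-6) 2(9)])
  next
    case (3 a b c d W)
    show ?case by (rule pair_graph.B3_plus_bound[OF pg 3(7,8) free(3) 3(1-6) 3(9)])
  qed
  show "card (pverts G) \<le> ?N" by (rule card_V_le)
qed

end
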